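(* Let $\mathcal{K}=\mathcal{K}^1\times\cdots\times\mathcal{K}^s$, where each $\mathcal{K}^i$ is a pointed closed convex cone in a finite-dimensional real inner product space $\mathcal{E}^i$. Let $\mathcal{L}\subseteq\mathcal{E}=\mathcal{E}^1\times\cdots\times\mathcal{E}^s$ be a subspace and $a\in\mathcal{E}$ such that $\mathcal{K}\cap(\mathcal{L}+a)\ne\emptyset$. Then there is a chain of faces of $\mathcal{K}$ $$\mathcal{F}_{d_{\mathrm{PPS}}(\mathcal{L},a)+1}\subsetneq\cdots\subsetneq\mathcal{F}_1=\mathcal{K}$$ together with $z_i\in\mathcal{F}_i^*\cap\mathcal{L}^\perp\cap\{a\}^\perp$ such that $\mathcal{F}_{i+1}=\mathcal{F}_i\cap\{z_i\}^\perp$ for every $i\in\{1,\dots,d_{\mathrm{PPS}}(\mathcal{L},a)\}$ and $(\mathcal{F}_{d_{\mathrm{PPS}}(\mathcal{L},a)+1},\mathcal{L},a)$ satisfies the PPS condition, and the following bounds hold: (i) $d_{\mathrm{PPS}}(\mathcal{L},a)\le\sum_{i=1}^s\ell_{\mathrm{poly}}(\mathcal{K}^i)$; (ii) $d_{\mathrm{PPS}}(\mathcal{L},a)\le\dim(\mathcal{L}^\perp\cap\{a\}^\perp)$; (iii) $d_{\mathrm{PPS}}(\mathcal{L},a)\le d_{\mathrm{S}}(\mathcal{L},a)$.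
   Context: Product spaces carry the sum inner product. A convex cone is a nonempty set closed under nonnegative linear combinations; it is pointed if $\mathcal{K}\cap-\mathcal{K}=\{0\}$. A face of $\mathcal{K}$ is a convex cone $\mathcal{F}\subseteq\mathcal{K}$ such that $x,y\in\mathcal{K}$, $x+y\in\mathcal{F}$ imply $x,y\in\mathcal{F}$. $C^*=\{x:\langle x,y\rangle\ge0\ \forall y\in C\}$, $C^\perp$ is the orthogonal complement, $\operatorname{ri}$ the relative interior. PPS (partial polyhedral Slater) condition: for a closed convex cone $\mathcal{C}\subseteq\mathcal{E}$, $(\mathcal{C},\mathcal{L},a)$ satisfies the PPS condition if $\mathcal{E}$ can be written as an orthogonal product $\mathcal{E}=\mathcal{G}^1\times\mathcal{G}^2$ (a factor may be $\{0\}$) with $\mathcal{C}=\mathcal{C}^1\times\mathcal{C}^2$, where $\mathcal{C}^i\subseteq\mathcal{G}^i$ are closed convex cones, $\mathcal{C}^2$ is polyhedral, and there is $(x_1,x_2)\in\mathcal{L}+a$ with $x_1\in\operatorname{ri}\mathcal{C}^1$, $x_2\in\mathcal{C}^2$. (So it holds if $(\operatorname{ri}\mathcal{C})\cap(\mathcal{L}+a)\ne\emptyset$, or if $\mathcal{C}$ is polyhedral and $\mathcal{C}\cap(\mathcal{L}+a)\neq\emptyset$.) Reducing directions: consider sequences $\mathcal{F}_1=\mathcal{K}$, $z_i\in\mathcal{F}_i^*\cap\mathcal{L}^\perp\cap\{a\}^\perp$, $\mathcal{F}_{i+1}=\mathcal{F}_i\cap\{z_i\}^\perp$, $i=1,\dots,k$.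 $d_{\mathrm{PPS}}(\mathcal{L},a)$ is the minimum $k\ge0$ for which such a sequence exists with $(\mathcal{F}_{k+1},\mathcal{L},a)$ satisfying the PPS condition. The singularity degree $d_{\mathrm{S}}(\mathcal{L},a)$ is the minimum $k\geq 0$ for which such a sequence exists with $\mathcal{F}_{k+1}$ equal to the minimal face of $\mathcal{K}$ containing $\mathcal{K}\cap(\mathcal{L}+a)$ (equivalently, $(\operatorname{ri}\mathcal{F}_{k+1})\cap(\mathcal{L}+a)\ne\emptyset$). Both depend also on $\mathcal{K}$. Distance to polyhedrality: $\ell_{\mathrm{poly}}(\mathcal{C})$ is the length minus one of the longest chain of nonempty faces $\mathcal{G}_\ell\subsetneq\cdots\subsetneq\mathcal{G}_1$ of $\mathcal{C}$ (length $\ell$) such that $\mathcal{G}_\ell$ is polyhedral and $\mathcal{G}_j$ is not polyhedral for $j<\ell$. *)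

theory Defs
  imports "HOL-Analysis.Analysis"
begin

(*
  An inner product space of arbitrary finite dimension (possibly 0) is represented by a subspace E
  of a Euclidean space.  Dual cones and orthogonal complements therefore take E as an argument.
  The library notions polyhedron, rel_interior and closed need no such argument: for subsets of a
  subspace they do not depend on whether they are taken in the subspace or in the whole space.
*)

(* The sum inner product on the product is the inner product of the type 'a ^ 's. *)
definition cart_prod :: "('s::finite \<Rightarrow> 'a set) \<Rightarrow> ('a ^ 's) set" where
  "cart_prod S = {x. \<forall>i. x $ i \<in> S i}"

definition pointed :: "'a::real_vector set \<Rightarrow> bool" where
  "pointed K \<longleftrightarrow> K \<inter> uminus ` K = {0}"

definition cone_face :: "'a::real_vector set \<Rightarrow> 'a set \<Rightarrow> bool" where
  "cone_face F K \<longleftrightarrow>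
     convex_cone F \<and> F \<subseteq> K \<and> (\<forall>x\<in>K. \<forall>y\<in>K. x + y \<in> F \<longrightarrow> x \<in> F \<and> y \<in> F)"

definition dual_cone :: "'a::real_inner set \<Rightarrow> 'a set \<Rightarrow> 'a set" where
  "dual_cone E C = {x \<in> E. \<forall>y\<in>C. 0 \<le> x \<bullet> y}"

definition perp :: "'a::euclidean_space set \<Rightarrow> 'a set \<Rightarrow> 'a set" where
  "perp E C = E \<inter> C\<^sup>\<bottom>"

(* The orthogonal product G1 x G2 is taken internally, as a sum of orthogonal subspaces of E; it
   need not be compatible with any other product structure on E. *)
definition PPS :: "'a::euclidean_space set \<Rightarrow> 'a set \<Rightarrow> 'a set \<Rightarrow> 'a \<Rightarrow> bool" where
  "PPS E C L a \<longleftrightarrow>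
     (\<exists>G1 G2 C1 C2.
        subspace G1 \<and> subspace G2 \<and> (\<forall>x\<in>G1. \<forall>y\<in>G2. orthogonal x y) \<and> E = G1 + G2 \<and>
        C1 \<subseteq> G1 \<and> closed C1 \<and> convex_cone C1 \<and>
        C2 \<subseteq> G2 \<and> closed C2 \<and> convex_cone C2 \<and> polyhedron C2 \<and>
        C = C1 + C2 \<and>
        (\<exists>x1 x2. x1 + x2 \<in> (+) a ` L \<and> x1 \<in> rel_interior C1 \<and> x2 \<in> C2))"

definition reducing_seq ::
  "'a::euclidean_space set \<Rightarrow> 'a set \<Rightarrow> 'a set \<Rightarrow> 'a \<Rightarrow> nat \<Rightarrow> (nat \<Rightarrow> 'a set) \<Rightarrow> (nat \<Rightarrow> 'a) \<Rightarrow> bool"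
where
  "reducing_seq E K L a k F z \<longleftrightarrow>
     F 1 = K \<and>
     (\<forall>i\<in>{1..k}. z i \<in> dual_cone E (F i) \<inter> perp E L \<inter> perp E {a} \<and>
                  F (i + 1) = F i \<inter> perp E {z i})"

definition d_PPS :: "'a::euclidean_space set \<Rightarrow> 'a set \<Rightarrow> 'a set \<Rightarrow> 'a \<Rightarrow> nat" where
  "d_PPS E K L a = (LEAST k. \<exists>F z. reducing_seq E K L a k F z \<and> PPS E (F (k + 1)) L a)"

(* The intersection of any family of faces of K is again a face of K. *)
definition minimal_face :: "'a::real_vector set \<Rightarrow> 'a set \<Rightarrow> 'a set" where
  "minimal_face K S = \<Inter>{F. cone_face F K \<and> S \<subseteq> F}"

definition d_S :: "'a::euclidean_space set \<Rightarrow> 'a set \<Rightarrow> 'a set \<Rightarrow> 'a \<Rightarrow> nat" where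
  "d_S E K L a =
     (LEAST k. \<exists>F z. reducing_seq E K L a k F z \<and>
                     F (k + 1) = minimal_face K (K \<inter> (+) a ` L))"

definition poly_chain :: "'a::euclidean_space set \<Rightarrow> nat \<Rightarrow> (nat \<Rightarrow> 'a set) \<Rightarrow> bool" where
  "poly_chain C l G \<longleftrightarrow>
     1 \<le> l \<and> (\<forall>j\<in>{1..l}. cone_face (G j) C) \<and> (\<forall>j\<in>{1..<l}. G (j + 1) \<subset> G j) \<and>
     polyhedron (G l) \<and> (\<forall>j\<in>{1..<l}. \<not> polyhedron (G j))"

(* The maximum exists for closed convex cones: the lineality space is a polyhedral face, and a
   proper face of a face has smaller dimension. *)
definition l_poly :: "'a::euclidean_space set \<Rightarrow> nat" where
  "l_poly C = (GREATEST l. \<exists>G. poly_chain C l G) - 1"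

end

theory Submission
  imports Defs
begin

text \<open>
  Split the factors of a product cone into polyhedral and non-polyhedral ones. If the PPS condition
  fails for this splitting, a separation theorem yields a reducing direction that does not vanish on
  the non-polyhedral part, so the next face is smaller in some non-polyhedral factor and the sum of
  the distances to polyhedrality drops; this gives (i). A shortest reducing sequence repeats no face,
  so its directions are linearly independent, which gives (ii). For (iii), the relative interior of
  the minimal face meets the affine space, so the PPS condition holds there with trivial polyhedral
  factor.
\<close>

subsection \<open>Partial polyhedral separation\<close>

text \<open>An arbitrary separating normal may vanish on the non-polyhedral part; then only
  polyhedral factors shrink and the sum of the distances need not move. The separation therefore has
  to be proper on the non-polyhedral part. This is possible because the polyhedral part can be
  handled through its finitely many inequalities, without passing to its relative interior. A cut
  can make a factor polyhedral, so the splitting is chosen anew at every step. Pointedness makes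
  \<open>{0}\<close> a face, which guarantees longest chains in all cones that occur. Both degrees
  are \<open>LEAST\<close> values and say something only if a qualifying sequence exists: for
  \<open>d_PPS\<close> existence comes along with (i), for \<open>d_S\<close> it comes from a facial
  reduction that lowers the dimension.\<close>

lemma in_convex_cone_hull_if_dual:
  fixes y :: "'b::euclidean_space"
  assumes "finite T" and dual: "\<And>x. (\<forall>t\<in>T. 0 \<le> t \<bullet> x) \<Longrightarrow> 0 \<le> y \<bullet> x"
  shows "y \<in> convex_cone hull T"
proof (rule ccontr)
  assume "y \<notin> convex_cone hull T"
  \<comment> \<open>Farkas' lemma: the cone generated by finitely many vectors is closed, hence
    strictly separable from a point outside it.\<close>
  then obtain c b where c: "c \<bullet> y < b" and b: "\<And>x. x \<in> convex_cone hull T \<Longrightarrow> b < c \<bullet> x"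
    using separating_hyperplane_closed_point[of "convex_cone hull T" y]
      closed_convex_cone_hull[OF \<open>finite T\<close>] convex_convex_cone_hull by metis
  have "b < 0" using b[of 0] by (simp add: convex_cone_hull_contains_0)
  have "0 \<le> t \<bullet> c" if "t \<in> T" for t
  proof (rule ccontr)
    assume neg: "\<not> 0 \<le> t \<bullet> c"
    \<comment> \<open>The multiple of \<open>t\<close> on which \<open>c\<close> takes exactly the
      value \<open>b\<close>, against the strict inequality.\<close>
    define r where "r = b / (t \<bullet> c)"
    have "r \<ge> 0" using neg \<open>b < 0\<close> unfolding r_def by (simp add: divide_nonpos_neg)
    then have "r *\<^sub>R t \<in> convex_cone hull T" using that by (simp add: convex_cone_hull_mul hull_inc)
    then have "b < c \<bullet> (r *\<^sub>R t)" by (rule b)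
    then show False using neg by (simp add: r_def inner_commute)
  qed
  then show False using dual[of c] c \<open>b < 0\<close> by (simp add: inner_commute)
qed

text \<open>The bounds \<open>q\<close> are nonnegative since the cone contains 0, and scaling up a
  point with a positive value would exceed them; so all of them can be replaced by 0.\<close>

lemma polyhedral_cone_halfspaces:
  fixes C :: "'b::euclidean_space set"
  assumes "convex_cone C" "polyhedron C"
  obtains B where "finite B" "C = {x. \<forall>b\<in>B. 0 \<le> b \<bullet> x}"
proof -
  obtain F p q where F: "finite F" "C = \<Inter> F" and pq: "\<And>h. h \<in> F \<Longrightarrow> h = {x. p h \<bullet> x \<le> q h}"
    using assms(2) unfolding polyhedron_def by metis
  have q: "0 \<le> q h" if "h \<in> F" for h
  proof -
    have "0 \<in> h" using convex_cone_contains_0[OF assms(1)] F(2) that by auto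
    then show ?thesis using pq[OF that] by (metis inner_zero_right mem_Collect_eq)
  qed
  have "p h \<bullet> x \<le> 0" if "h \<in> F" "x \<in> C" for h x
  proof (rule ccontr)
    assume pos: "\<not> p h \<bullet> x \<le> 0"
    define r where "r = (q h + 1) / (p h \<bullet> x)"
    have "r \<ge> 0" using pos q[OF that(1)] by (simp add: r_def)
    then have "r *\<^sub>R x \<in> h"
      using convex_cone_scaleR[OF assms(1) _ that(2)] F(2) that(1) by auto
    then have "p h \<bullet> (r *\<^sub>R x) \<le> q h" using pq[OF that(1)] by blast
    then show False using pos by (simp add: r_def)
  qed
  moreover have "x \<in> C" if "\<And>h. h \<in> F \<Longrightarrow> p h \<bullet> x \<le> 0" for x
    using that q pq F(2) by fastforce
  ultimately have "C = {x. \<forall>b\<in>(\<lambda>h. - p h) ` F. 0 \<le> b \<bullet> x}" by auto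
  with F(1) show thesis by (intro that[of "(\<lambda>h. - p h) ` F"]) auto
qed

lemma rel_interior_cone_scaleR:
  fixes C :: "'b::euclidean_space set"
  assumes "convex_cone C" "x \<in> rel_interior C" "0 < r"
  shows "r *\<^sub>R x \<in> rel_interior C"
proof -
  have "(*\<^sub>R) r ` C = C"
  proof
    show "(*\<^sub>R) r ` C \<subseteq> C" using assms convex_cone_scaleR by fastforce
    have "y = r *\<^sub>R (inverse r *\<^sub>R y)" "inverse r *\<^sub>R y \<in> C" if "y \<in> C" for y
      using assms(3) convex_cone_scaleR[OF assms(1) _ that] by auto
    then show "C \<subseteq> (*\<^sub>R) r ` C" by blast
  qed
  then show ?thesis using rel_interior_scaleR[of r C] assms by auto
qed

text \<open>The sum is twice the midpoint, and the midpoint of a relative interior point and a point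
  of the cone is again in the relative interior.\<close>

lemma rel_interior_cone_add:
  fixes C :: "'b::euclidean_space set"
  assumes "convex_cone C" "x \<in> rel_interior C" "y \<in> C"
  shows "x + y \<in> rel_interior C"
proof -
  have "y - (1/2) *\<^sub>R (y - x) \<in> rel_interior C"
    using assms by (intro rel_interior_convex_shrink) (auto simp: convex_cone_def)
  then have "2 *\<^sub>R (y - (1/2) *\<^sub>R (y - x)) \<in> rel_interior C"
    using rel_interior_cone_scaleR[OF assms(1)] by simp
  then show ?thesis by (simp add: algebra_simps scaleR_2)
qed

lemma cone_nonneg_if_rel_interior_nonneg:
  fixes C :: "'b::euclidean_space set"
  assumes "convex C" "\<And>x. x \<in> rel_interior C \<Longrightarrow> 0 \<le> c \<bullet> x" "x \<in> C"
  shows "0 \<le> c \<bullet> x"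
proof -
  have "closure (rel_interior C) \<subseteq> {x. c \<bullet> x \<ge> 0}"
    using assms(2) by (intro closure_minimal) (auto simp: closed_halfspace_ge)
  then show ?thesis using assms closure_subset[of C] by (auto simp: convex_closure_rel_interior)
qed

text \<open>The separating vector is to be nonzero on the cone that need not be polyhedral. So the
  relative interior of \<open>C1\<close> plus \<open>V\<close>, the complement of its span, is separated first: this forces
  the normal \<open>c\<close> into the span of \<open>C1\<close>. Farkas' lemma then splits \<open>- c\<close> into a part orthogonal to
  \<open>M\<close> and a part in the dual of \<open>C2\<close>.\<close>

lemma partial_polyhedral_separation:
  fixes C1 C2 M :: "'b::euclidean_space set"
  assumes C1: "convex_cone C1" and C2: "convex_cone C2" "polyhedron C2"
    and ortho: "\<And>x y. x \<in> C1 \<Longrightarrow> y \<in> C2 \<Longrightarrow> x \<bullet> y = 0"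
    and M: "subspace M"
    and disj: "\<And>x y. x \<in> rel_interior C1 \<Longrightarrow> y \<in> C2 \<Longrightarrow> x + y \<notin> M"
  shows "\<exists>z. (\<forall>x\<in>M. z \<bullet> x = 0) \<and> (\<forall>x\<in>C1 \<union> C2. 0 \<le> z \<bullet> x) \<and> (\<exists>x\<in>C1. z \<bullet> x \<noteq> 0)"
proof -
  define V where "V = (span C1)\<^sup>\<bottom>"
  have subV: "subspace V" by (simp add: V_def subspace_orthogonal_comp)
  have V_C1: "v \<bullet> x = 0" if "v \<in> V" "x \<in> C1" for v x
    using that span_base[of x C1] by (auto simp: V_def orthogonal_comp_def orthogonal_def inner_commute)
  have C2V: "y \<in> V" if "y \<in> C2" for y
  proof -
    have "orthogonal y x" if "x \<in> span C1" for x
      using that by (rule orthogonal_to_span) (use \<open>y \<in> C2\<close> ortho in \<open>auto simp: orthogonal_def inner_commute\<close>)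
    then show ?thesis by (auto simp: V_def orthogonal_comp_def orthogonal_commute)
  qed
  obtain B where B: "finite B" "C2 = {x. \<forall>b\<in>B. 0 \<le> b \<bullet> x}"
    using polyhedral_cone_halfspaces[OF C2] by blast
  \<comment> \<open>As \<open>C2\<close> lies in \<open>V\<close>, its normals can be replaced by
    their projections to \<open>V\<close>, which vanish on \<open>C1\<close> and thus test only the
    \<open>V\<close>-part of a sum.\<close>
  have "\<exists>p. p \<in> V \<and> (\<forall>v\<in>V. p \<bullet> v = b \<bullet> v)" for b
  proof -
    obtain p q where "p \<in> span V" "\<And>v. v \<in> span V \<Longrightarrow> orthogonal q v" "b = p + q"
      using orthogonal_subspace_decomp_exists[of V b] by blast
    then show ?thesis
      using subV by (intro exI[of _ p]) (simp add: span_eq_iff[THEN iffD2] orthogonal_def inner_left_distrib)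
  qed
  then obtain p where pV: "\<And>b. p b \<in> V" and p: "\<And>b v. v \<in> V \<Longrightarrow> p b \<bullet> v = b \<bullet> v" by metis
  \<comment> \<open>The inequalities of \<open>C2\<close> move to the side of \<open>M\<close>,
    which leaves all of \<open>V\<close> in place of \<open>C2\<close> on the other side. The sets
    stay disjoint: a common point \<open>x + v\<close> would lie in \<open>M\<close> and have
    \<open>v\<close> in \<open>C2\<close>.\<close>
  define N where "N = {x \<in> M. \<forall>b\<in>B. 0 \<le> p b \<bullet> x}"
  define R where "R = (\<Union>x\<in>rel_interior C1. \<Union>v\<in>V. {x + v})"
  have N: "convex_cone N"
    using M by (auto simp: N_def convex_cone_iff subspace_def inner_right_distrib)
  have riC1: "rel_interior C1 \<noteq> {}" "rel_interior C1 \<subseteq> C1"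
    using C1 rel_interior_eq_empty rel_interior_subset by (auto simp: convex_cone_def)
  have "N \<inter> R = {}"
  proof -
    have False if "x \<in> rel_interior C1" "v \<in> V" "x + v \<in> N" for x v
    proof -
      have "0 \<le> b \<bullet> v" if "b \<in> B" for b
      proof -
        have "p b \<bullet> x = 0" using V_C1[OF pV] riC1(2) \<open>x \<in> rel_interior C1\<close> by auto
        moreover have "0 \<le> p b \<bullet> x + p b \<bullet> v"
          using \<open>x + v \<in> N\<close> that by (auto simp: N_def inner_right_distrib)
        ultimately show ?thesis using p[OF \<open>v \<in> V\<close>, of b] by simp
      qed
      then have "v \<in> C2" by (simp add: B(2))
      then show False using disj[OF that(1)] that(3) by (auto simp: N_def)
    qed
    then show ?thesis by (auto simp: R_def)
  qed
  moreover have "convex R" unfolding R_def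
    using C1 subspace_imp_convex[OF subV] by (intro convex_sums convex_rel_interior) (simp_all add: convex_cone_def)
  moreover have "R \<noteq> {}" using riC1 subspace_0[OF subV] by (auto simp: R_def)
  moreover have "convex N" "N \<noteq> {}" using N by (auto simp: convex_cone_def)
  ultimately obtain c \<beta> where "c \<noteq> 0" and cN: "\<And>x. x \<in> N \<Longrightarrow> c \<bullet> x \<le> \<beta>" and cR: "\<And>x. x \<in> R \<Longrightarrow> c \<bullet> x \<ge> \<beta>"
    using separating_hyperplane_sets[of N R] by blast
  have "\<beta> \<ge> 0" using cN[of 0] convex_cone_contains_0[OF N] by simp
  have cR': "c \<bullet> x + c \<bullet> v \<ge> 0" if "x \<in> rel_interior C1" "v \<in> V" for x v
    using cR[of "x + v"] that \<open>\<beta> \<ge> 0\<close> by (force simp: R_def inner_right_distrib)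
  have cN': "c \<bullet> x \<le> 0" if "x \<in> N" for x
  proof (rule ccontr)
    assume pos: "\<not> c \<bullet> x \<le> 0"
    define r where "r = (\<beta> + 1) / (c \<bullet> x)"
    have "r \<ge> 0" using pos \<open>\<beta> \<ge> 0\<close> by (simp add: r_def)
    then have "c \<bullet> (r *\<^sub>R x) \<le> \<beta>" using convex_cone_scaleR[OF N _ that] cN by blast
    then show False using pos by (simp add: r_def)
  qed
  obtain x0 where x0: "x0 \<in> rel_interior C1" using riC1 by blast
  have cV: "c \<bullet> v = 0" if "v \<in> V" for v
  proof (rule ccontr)
    assume nz: "c \<bullet> v \<noteq> 0"
    \<comment> \<open>Chosen so that \<open>c\<close> takes the value -1 at
      \<open>x0 + r *\<^sub>R v\<close>.\<close>
    define r where "r = - (c \<bullet> x0 + 1) / (c \<bullet> v)"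
    have "r *\<^sub>R v \<in> V" using subV that by (simp add: subspace_scale)
    from cR'[OF x0 this] show False using nz by (simp add: r_def)
  qed
  then have cW: "c \<in> span C1"
    using orthogonal_comp_self[of "span C1"] by (auto simp: V_def orthogonal_comp_def orthogonal_def inner_commute)
  have cC1: "0 \<le> c \<bullet> x" if "x \<in> C1" for x
    using cR'[of _ 0] subspace_0[OF subV] C1 that
    by (intro cone_nonneg_if_rel_interior_nonneg[of C1 c x]) (auto simp: convex_cone_def)
  \<comment> \<open>A nonzero vector in the span of \<open>C1\<close> cannot be orthogonal to all of
    \<open>C1\<close>; this is what \<open>cW\<close> was for.\<close>
  have cne: "\<exists>x\<in>C1. c \<bullet> x \<noteq> 0"
  proof (rule ccontr)
    assume "\<not> ?thesis"
    then have "orthogonal c c"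
      by (intro orthogonal_to_span[OF cW]) (auto simp: orthogonal_def)
    then show False using \<open>c \<noteq> 0\<close> by (simp add: orthogonal_def)
  qed
  obtain D where D: "D \<subseteq> M\<^sup>\<bottom>" "finite D" "span D = M\<^sup>\<bottom>"
    using basis_exists[of "M\<^sup>\<bottom>"] subspace_orthogonal_comp[of M]
    by (metis finiteI_independent span_minimal subset_antisym)
  \<comment> \<open>With its negatives, \<open>D\<close> generates the orthogonal complement of
    \<open>M\<close> as a cone. A vector nonnegative against \<open>T1 \<union> T2\<close> thus lies
    in \<open>N\<close>, where \<open>c\<close> is nonpositive.\<close>
  define T1 T2 where "T1 = D \<union> uminus ` D" and "T2 = p ` B"
  have "- c \<in> convex_cone hull (T1 \<union> T2)"
  proof (rule in_convex_cone_hull_if_dual)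
    show "finite (T1 \<union> T2)" using D B by (simp add: T1_def T2_def)
    fix x assume x: "\<forall>t\<in>T1 \<union> T2. 0 \<le> t \<bullet> x"
    have "d \<bullet> x = 0" if "d \<in> D" for d
    proof -
      have "0 \<le> d \<bullet> x" "0 \<le> (- d) \<bullet> x" using x that unfolding T1_def by blast+
      then show ?thesis by simp
    qed
    then have "orthogonal x d" if "d \<in> span D" for d
      using that by (intro orthogonal_to_span[OF that]) (auto simp: orthogonal_def inner_commute)
    then have "x \<in> M\<^sup>\<bottom>\<^sup>\<bottom>" using D(3) by (auto simp: orthogonal_comp_def orthogonal_commute)
    then have "x \<in> M" using orthogonal_comp_self[OF M] by simp
    then have "x \<in> N" using x by (auto simp: N_def T2_def)
    then show "0 \<le> (- c) \<bullet> x" using cN' by simp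
  qed
  then obtain m u where m: "m \<in> convex_cone hull T1" and u: "u \<in> convex_cone hull T2" and cmu: "- c = m + u"
    by (auto simp: convex_cone_hull_Un)
  have "convex_cone hull T1 \<subseteq> M\<^sup>\<bottom>"
    using D(1) subspace_orthogonal_comp[of M] subspace_neg
    by (intro hull_minimal subspace_imp_convex_cone) (auto simp: T1_def)
  then have mM: "m \<bullet> x = 0" if "x \<in> M" for x
    using m that by (auto simp: orthogonal_comp_def orthogonal_def inner_commute)
  have "convex_cone hull T2 \<subseteq> V \<inter> {u. \<forall>x\<in>C2. 0 \<le> u \<bullet> x}"
  proof (rule hull_minimal)
    show "T2 \<subseteq> V \<inter> {u. \<forall>x\<in>C2. 0 \<le> u \<bullet> x}"
      using pV p C2V B(2) by (auto simp: T2_def)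
    show "convex_cone (V \<inter> {u. \<forall>x\<in>C2. 0 \<le> u \<bullet> x})"
      using subV by (auto simp: convex_cone_iff subspace_def inner_left_distrib)
  qed
  with u have uV: "u \<in> V" and uC2: "\<And>x. x \<in> C2 \<Longrightarrow> 0 \<le> u \<bullet> x" by auto
  \<comment> \<open>On \<open>C1\<close> this vector agrees with \<open>c\<close>, because
    \<open>u\<close> lies in \<open>V\<close>; on \<open>C2\<close> it agrees with \<open>u\<close>,
    because \<open>c\<close> vanishes on \<open>V\<close>.\<close>
  have z: "- m = c + u" using cmu by (simp add: algebra_simps neg_eq_iff_add_eq_0)
  show ?thesis
  proof (intro exI[of _ "- m"] conjI ballI)
    show "(- m) \<bullet> x = 0" if "x \<in> M" for x using mM[OF that] by simp
    show "0 \<le> (- m) \<bullet> x" if "x \<in> C1 \<union> C2" for x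
      using cC1 V_C1[OF uV] cV[OF C2V] uC2 that unfolding z by (auto simp: inner_left_distrib)
    show "\<exists>x\<in>C1. (- m) \<bullet> x \<noteq> 0"
      using cne V_C1[OF uV] unfolding z by (simp add: inner_left_distrib)
  qed
qed

text \<open>Homogenization: the affine space is replaced by the span of \<open>a\<close> and
  \<open>L\<close>. A point of this span with a positive coefficient at \<open>a\<close> can be
  rescaled into the affine space; otherwise a multiple of the feasible point \<open>s1 + s2\<close>
  corrects the coefficient. Both moves stay in the relative interior of \<open>C1\<close> plus
  \<open>C2\<close>.\<close>

lemma partial_polyhedral_separation_affine:
  fixes C1 C2 E L :: "'b::euclidean_space set"
  assumes C1: "convex_cone C1" and C2: "convex_cone C2" "polyhedron C2"
    and ortho: "\<And>x y. x \<in> C1 \<Longrightarrow> y \<in> C2 \<Longrightarrow> x \<bullet> y = 0"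
    and E: "subspace E" "C1 \<subseteq> E" "C2 \<subseteq> E" "L \<subseteq> E" "a \<in> E"
    and L: "subspace L"
    and s: "s1 \<in> C1" "s2 \<in> C2" "s1 + s2 \<in> (+) a ` L"
    and disj: "\<And>x y. x \<in> rel_interior C1 \<Longrightarrow> y \<in> C2 \<Longrightarrow> x + y \<notin> (+) a ` L"
  shows "\<exists>z \<in> perp E L \<inter> perp E {a}. (\<forall>x\<in>C1 \<union> C2. 0 \<le> z \<bullet> x) \<and> (\<exists>x\<in>C1. z \<bullet> x \<noteq> 0)"
proof -
  have disj': "x + y \<notin> span (insert a L)" if "x \<in> rel_interior C1" "y \<in> C2" for x y
  proof
    assume "x + y \<in> span (insert a L)"
    then obtain t where "x + y - t *\<^sub>R a \<in> span L" by (auto simp: span_breakdown_eq)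
    then have "x + y - t *\<^sub>R a \<in> L" using L by (simp add: span_eq_iff[THEN iffD2])
    then obtain l where l: "l \<in> L" and xy: "x + y = t *\<^sub>R a + l"
      by (metis add.commute diff_add_cancel)
    obtain l' where l': "l' \<in> L" "s1 + s2 = a + l'" using s by auto
    show False
    proof (cases "t > 0")
      case True
      have "inverse t *\<^sub>R x + inverse t *\<^sub>R y = inverse t *\<^sub>R (x + y)" by (simp add: scaleR_add_right)
      also have "\<dots> = a + inverse t *\<^sub>R l" using True by (simp add: xy scaleR_add_right)
      finally have "inverse t *\<^sub>R x + inverse t *\<^sub>R y \<in> (+) a ` L" using l L by (auto simp: subspace_scale)
      then show False
        using disj[of "inverse t *\<^sub>R x" "inverse t *\<^sub>R y"] True that C1 C2
        by (simp add: rel_interior_cone_scaleR convex_cone_scaleR)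
    next
      case False
      \<comment> \<open>The factor \<open>1 - t\<close> lifts the coefficient of \<open>a\<close>
        from \<open>t\<close> to 1.\<close>
      have "(x + (1 - t) *\<^sub>R s1) + (y + (1 - t) *\<^sub>R s2) = (x + y) + (1 - t) *\<^sub>R (s1 + s2)"
        by (simp add: algebra_simps)
      also have "\<dots> = a + (l + (1 - t) *\<^sub>R l')" by (simp add: xy l' algebra_simps)
      finally have "(x + (1 - t) *\<^sub>R s1) + (y + (1 - t) *\<^sub>R s2) \<in> (+) a ` L"
        using l l' L by (auto simp: subspace_scale subspace_add)
      then show False
        using disj[of "x + (1 - t) *\<^sub>R s1" "y + (1 - t) *\<^sub>R s2"] False that C1 C2 s
        by (simp add: rel_interior_cone_add convex_cone_scaleR convex_cone_add)
    qed
  qed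
  obtain z where zM: "\<forall>x\<in>span (insert a L). z \<bullet> x = 0"
    and zC: "\<forall>x\<in>C1 \<union> C2. 0 \<le> z \<bullet> x" and zne: "\<exists>x\<in>C1. z \<bullet> x \<noteq> 0"
    using partial_polyhedral_separation[OF C1 C2 ortho subspace_span disj'] by blast
  \<comment> \<open>The separation takes place in the whole space; projecting to \<open>E\<close>
    keeps all inner products with vectors of \<open>E\<close>.\<close>
  obtain p q where p: "p \<in> span E" "\<And>v. v \<in> span E \<Longrightarrow> orthogonal q v" "z = p + q"
    using orthogonal_subspace_decomp_exists[of E z] by blast
  have pz: "p \<bullet> v = z \<bullet> v" if "v \<in> E" for v
    using p(2)[of v] p(3) that by (simp add: span_base orthogonal_def inner_left_distrib)
  have pE: "p \<in> E" using p(1) E(1) by (metis span_eq_iff)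
  show ?thesis
  proof (rule bexI[of _ p], intro conjI ballI)
    have "p \<bullet> x = 0" if "x \<in> insert a L" for x
      using zM pz[of x] that E by (auto simp: span_base)
    then show "p \<in> perp E L \<inter> perp E {a}"
      using pE by (auto simp: perp_def orthogonal_comp_def orthogonal_def inner_commute)
    show "0 \<le> p \<bullet> x" if "x \<in> C1 \<union> C2" for x using zC pz that E by auto
    show "\<exists>x\<in>C1. p \<bullet> x \<noteq> 0" using zne pz E(2) by (metis subsetD)
  qed
qed

subsection \<open>Faces of convex cones\<close>

lemma cone_face_refl: "convex_cone K \<Longrightarrow> cone_face K K"
  by (auto simp: cone_face_def)

lemma cone_face_trans: "cone_face F G \<Longrightarrow> cone_face G K \<Longrightarrow> cone_face F K"
  unfolding cone_face_def by blast

lemma cone_face_subset: "cone_face F K \<Longrightarrow> cone_face G K \<Longrightarrow> F \<subseteq> G \<Longrightarrow> cone_face F G"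
  unfolding cone_face_def by blast

lemma cone_face_exposed:
  assumes "convex_cone F" "\<And>x. x \<in> F \<Longrightarrow> 0 \<le> z \<bullet> x"
  shows "cone_face {x \<in> F. z \<bullet> x = 0} F"
  using assms
  by (auto simp: cone_face_def convex_cone_iff inner_right_distrib add_nonneg_eq_0_iff)

text \<open>Weighted endpoints of a segment stay in the cone and sum to a point of the face, and
  dividing by the weight recovers the endpoint. This gives access to dimension, closedness and
  relative interior facts for convex faces.\<close>

lemma cone_face_imp_face_of:
  assumes "convex_cone K" "cone_face F K"
  shows "F face_of K"
  unfolding face_of_def
proof (intro conjI ballI impI)
  show "F \<subseteq> K" "convex F" using assms by (auto simp: cone_face_def convex_cone_def)
  have *: "p \<in> F" if "p \<in> K" "q \<in> K" "r *\<^sub>R p + s *\<^sub>R q \<in> F" "r > 0" "s > 0" for p q r s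
  proof -
    have "r *\<^sub>R p \<in> F"
      using that assms convex_cone_scaleR[OF assms(1)] unfolding cone_face_def
      by (meson less_imp_le)
    then show ?thesis
      using convex_cone_scaleR[of F "inverse r" "r *\<^sub>R p"] assms(2) that(4)
      by (simp add: cone_face_def)
  qed
  fix p q x assume pq: "p \<in> K" "q \<in> K" "x \<in> F" "x \<in> open_segment p q"
  then obtain u where u: "0 < u" "u < 1" "x = (1 - u) *\<^sub>R p + u *\<^sub>R q"
    by (auto simp: in_segment)
  show "p \<in> F" using *[of p q "1 - u" u] pq u by simp
  show "q \<in> F" using *[of q p u "1 - u"] pq u by (simp add: add.commute)
qed

lemma pointed_subset:
  assumes "pointed K" "convex_cone F" "F \<subseteq> K"
  shows "pointed F"
  using assms convex_cone_contains_0[OF assms(2)] unfolding pointed_def by force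

subsection \<open>Distance to polyhedrality\<close>

text \<open>Passing to a proper face lowers the affine dimension, which has only the
  \<open>DIM('b) + 2\<close> values from -1 to \<open>DIM('b)\<close>. This is the boundedness that
  \<open>GREATEST\<close> needs.\<close>

lemma poly_chain_length:
  fixes C :: "'b::euclidean_space set"
  assumes "convex_cone C" "poly_chain C l G"
  shows "l \<le> DIM('b) + 2"
proof -
  have G: "cone_face (G j) C" if "j \<in> {1..l}" for j using assms(2) that by (auto simp: poly_chain_def)
  have "aff_dim (G j) + int j \<le> int DIM('b) + 1" if "1 \<le> j" "j \<le> l" for j
    using that
  proof (induction j rule: dec_induct)
    case base
    then show ?case using aff_dim_le_DIM[of "G 1"] by simp
  next
    case (step j)
    have sub: "G (Suc j) \<subset> G j" using assms(2) step by (auto simp: poly_chain_def)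
    have "cone_face (G (Suc j)) (G j)"
      using sub step by (intro cone_face_subset[OF G G]) auto
    moreover have "convex_cone (G j)" using G[of j] step by (auto simp: cone_face_def)
    ultimately have "aff_dim (G (Suc j)) < aff_dim (G j)"
      using sub by (intro face_of_aff_dim_lt cone_face_imp_face_of) (auto simp: convex_cone_def)
    then show ?case using step by simp
  qed
  from this[of l] have "aff_dim (G l) + int l \<le> int DIM('b) + 1"
    using assms(2) by (auto simp: poly_chain_def)
  then show ?thesis using aff_dim_geq[of "G l"] by linarith
qed

lemma poly_chain_le_l_poly:
  fixes C :: "'b::euclidean_space set"
  assumes "convex_cone C" "poly_chain C l G"
  shows "l \<le> l_poly C + 1"
proof -
  have "l \<le> (GREATEST l. \<exists>G. poly_chain C l G)"
    by (rule Greatest_le_nat[where b = "DIM('b) + 2"]) (use assms poly_chain_length in blast)+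
  then show ?thesis by (simp add: l_poly_def)
qed

text \<open>Pointedness makes \<open>{0}\<close> a polyhedral face, so chains exist. Their length is
  at least 1, so the truncated subtraction in \<open>l_poly\<close> loses nothing.\<close>

lemma l_poly_attained:
  fixes C :: "'b::euclidean_space set"
  assumes "convex_cone C" "pointed C"
  obtains G where "poly_chain C (l_poly C + 1) G"
proof -
  have "cone_face {0} C"
    unfolding cone_face_def
  proof (intro conjI ballI impI)
    show "{0} \<subseteq> C" using convex_cone_contains_0[OF assms(1)] by simp
    fix x y assume xy: "x \<in> C" "y \<in> C" "x + y \<in> {0}"
    then have "y = - x" by (simp add: eq_neg_iff_add_eq_0 add.commute)
    then have "x \<in> C \<inter> uminus ` C" "y \<in> C \<inter> uminus ` C" using xy by force+
    then show "x \<in> {0}" "y \<in> {0}" using assms(2) by (auto simp: pointed_def)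
  qed simp
  then have "poly_chain C 1 (\<lambda>_. {0})"
    by (simp add: poly_chain_def affine_imp_polyhedron)
  then have ex: "\<exists>G. poly_chain C (GREATEST l. \<exists>G. poly_chain C l G) G"
    by (intro GreatestI_nat[where P = "\<lambda>l. \<exists>G. poly_chain C l G" and b = "DIM('b) + 2"])
      (use assms poly_chain_length in blast)+
  then have "1 \<le> (GREATEST l. \<exists>G. poly_chain C l G)" by (auto simp: poly_chain_def)
  then have "l_poly C + 1 = (GREATEST l. \<exists>G. poly_chain C l G)" by (simp add: l_poly_def)
  with ex that show thesis by auto
qed

lemma l_poly_mono:
  fixes C :: "'b::euclidean_space set"
  assumes "convex_cone C" "pointed C" "cone_face F C"
  shows "l_poly F \<le> l_poly C"
proof -
  have "convex_cone F" "pointed F" using assms pointed_subset by (auto simp: cone_face_def)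
  then obtain G where "poly_chain F (l_poly F + 1) G" by (rule l_poly_attained)
  then have "poly_chain C (l_poly F + 1) G"
    using assms(3) cone_face_trans unfolding poly_chain_def by blast
  then show ?thesis using poly_chain_le_l_poly[OF assms(1)] by fastforce
qed

text \<open>A longest chain of \<open>F\<close> is prolonged by putting \<open>C\<close> in front,
  which is legal because \<open>C\<close> is not polyhedral.\<close>

lemma l_poly_less:
  fixes C :: "'b::euclidean_space set"
  assumes "convex_cone C" "pointed C" "cone_face F C" "F \<noteq> C" "\<not> polyhedron C"
  shows "l_poly F < l_poly C"
proof -
  have "convex_cone F" "pointed F" using assms pointed_subset by (auto simp: cone_face_def)
  then obtain G where G: "poly_chain F (l_poly F + 1) G" by (rule l_poly_attained)
  define G' where "G' j = (if j = 1 then C else G (j - 1))" for j :: nat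
  have "cone_face (G' j) C" if "j \<in> {1..l_poly F + 2}" for j
  proof (cases "j = 1")
    case False
    then have "j - 1 \<in> {1..l_poly F + 1}" using that by auto
    then have "cone_face (G (j - 1)) F" using G unfolding poly_chain_def by blast
    then show ?thesis using False assms(3) cone_face_trans by (auto simp: G'_def)
  qed (use assms(1) cone_face_refl in \<open>simp add: G'_def\<close>)
  moreover have "G' (j + 1) \<subset> G' j \<and> \<not> polyhedron (G' j)" if "j \<in> {1..<l_poly F + 2}" for j
  proof (cases "j = 1")
    case True
    have "cone_face (G 1) F" using G by (auto simp: poly_chain_def)
    then show ?thesis using True assms by (auto simp: G'_def cone_face_def)
  next
    case False
    then have "j - 1 \<in> {1..<l_poly F + 1}" using that by auto
    then have "G (j - 1 + 1) \<subset> G (j - 1) \<and> \<not> polyhedron (G (j - 1))"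
      using G unfolding poly_chain_def by blast
    then show ?thesis using False that by (auto simp: G'_def)
  qed
  moreover have "polyhedron (G' (l_poly F + 2))" using G by (auto simp: G'_def poly_chain_def)
  ultimately have "poly_chain C (l_poly F + 2) G'" by (auto simp: poly_chain_def)
  then show ?thesis using poly_chain_le_l_poly[OF assms(1)] by fastforce
qed

subsection \<open>Reducing sequences\<close>

lemma Int_perp_eq: "F \<subseteq> E \<Longrightarrow> F \<inter> perp E {z} = {x \<in> F. z \<bullet> x = 0}"
  by (auto simp: perp_def orthogonal_comp_def orthogonal_def)

lemma perp_affine:
  assumes "z \<in> perp E L \<inter> perp E {a}" "x \<in> (+) a ` L"
  shows "z \<bullet> x = 0"
  using assms
  by (auto simp: perp_def orthogonal_comp_def orthogonal_def inner_right_distrib inner_commute)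

lemma reducing_step_keeps_feasible:
  assumes "S \<subseteq> F" "S \<subseteq> (+) a ` L" "F \<subseteq> E" "z \<in> perp E L \<inter> perp E {a}"
  shows "S \<subseteq> F \<inter> perp E {z}"
  using assms perp_affine[OF assms(4)] by (auto simp: Int_perp_eq)

lemma cone_face_Int_perp:
  assumes "convex_cone F" "F \<subseteq> E" "z \<in> dual_cone E F"
  shows "cone_face (F \<inter> perp E {z}) F"
  unfolding Int_perp_eq[OF assms(2)] using assms
  by (intro cone_face_exposed) (auto simp: dual_cone_def)

lemma reducing_seq_Cons:
  assumes z0: "z0 \<in> dual_cone E K \<inter> perp E L \<inter> perp E {a}"
    and seq: "reducing_seq E (K \<inter> perp E {z0}) L a k F z"
  obtains F' z' where "reducing_seq E K L a (Suc k) F' z'" "F' (Suc k + 1) = F (k + 1)"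
proof (rule that[of "\<lambda>i. if i = 1 then K else F (i - 1)" "\<lambda>i. if i = 1 then z0 else z (i - 1)"])
  let ?F = "\<lambda>i. if i = 1 then K else F (i - 1)" and ?z = "\<lambda>i. if i = 1 then z0 else z (i - 1)"
  have "?z i \<in> dual_cone E (?F i) \<inter> perp E L \<inter> perp E {a} \<and> ?F (i + 1) = ?F i \<inter> perp E {?z i}"
    if i: "i \<in> {1..Suc k}" for i
  proof (cases "i = 1")
    case True
    then show ?thesis using z0 seq by (simp add: reducing_seq_def)
  next
    case False
    then obtain j where j: "i = Suc j" "j \<in> {1..k}" using i by (cases i) auto
    then show ?thesis using seq False by (auto simp: reducing_seq_def)
  qed
  then show "reducing_seq E K L a (Suc k) ?F ?z" by (auto simp: reducing_seq_def)
qed simp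

lemma reducing_seq_faces:
  assumes K: "convex_cone K" "K \<subseteq> E" and seq: "reducing_seq E K L a k F z"
    and i: "1 \<le> i" "i \<le> k + 1"
  shows "cone_face (F i) K"
  using i
proof (induction i rule: dec_induct)
  case base
  then show ?case using seq K cone_face_refl by (simp add: reducing_seq_def)
next
  case (step i)
  then have face: "cone_face (F i) K" by simp
  have "z i \<in> dual_cone E (F i)" "F (Suc i) = F i \<inter> perp E {z i}"
    using seq step by (auto simp: reducing_seq_def)
  then have "cone_face (F (Suc i)) (F i)"
    using face K cone_face_Int_perp[of "F i" E "z i"] by (auto simp: cone_face_def)
  then show ?case using face cone_face_trans by blast
qed

text \<open>A cut that removes nothing can be skipped. Faces shift after \<open>i\<close> but
  directions already from \<open>i\<close> on: the face at \<open>i\<close> equals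
  \<open>F (i + 1)\<close>, to which \<open>z (i + 1)\<close> belongs.\<close>

lemma reducing_seq_drop_repetition:
  assumes seq: "reducing_seq E K L a (Suc k) F z" and i: "i \<in> {1..Suc k}" "F (i + 1) = F i"
  obtains F' z' where "reducing_seq E K L a k F' z'" "F' (k + 1) = F (Suc k + 1)"
proof (rule that[of "\<lambda>j. if j \<le> i then F j else F (j + 1)" "\<lambda>j. if j < i then z j else z (j + 1)"])
  let ?F = "\<lambda>j. if j \<le> i then F j else F (j + 1)" and ?z = "\<lambda>j. if j < i then z j else z (j + 1)"
  have seq': "z j \<in> dual_cone E (F j) \<inter> perp E L \<inter> perp E {a}" "F (j + 1) = F j \<inter> perp E {z j}"
    if "j \<in> {1..Suc k}" for j using seq that by (auto simp: reducing_seq_def)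
  have "?z j \<in> dual_cone E (?F j) \<inter> perp E L \<inter> perp E {a} \<and> ?F (j + 1) = ?F j \<inter> perp E {?z j}"
    if j: "j \<in> {1..k}" for j
    using seq'[of j] seq'[of "j + 1"] i j by (cases j i rule: linorder_cases) auto
  then show "reducing_seq E K L a k ?F ?z"
    using seq i by (auto simp: reducing_seq_def)
  show "?F (k + 1) = F (Suc k + 1)" using i by (cases "i = Suc k") auto
qed

text \<open>Each \<open>F i\<close> is orthogonal to all earlier directions, so a direction in their span would cut
  nothing off.\<close>

lemma strict_reducing_seq_length:
  fixes E :: "'b::euclidean_space set"
  assumes "K \<subseteq> E" and seq: "reducing_seq E K L a k F z"
    and strict: "\<And>i. i \<in> {1..k} \<Longrightarrow> F (i + 1) \<subset> F i"
  shows "k \<le> dim (perp E L \<inter> perp E {a})"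
proof -
  have step: "z i \<in> perp E L \<inter> perp E {a}" "F (i + 1) = F i \<inter> perp E {z i}" if "i \<in> {1..k}" for i
    using seq that by (auto simp: reducing_seq_def)
  have sub: "F (Suc m) \<subseteq> E \<inter> {x. \<forall>i\<in>{1..m}. z i \<bullet> x = 0}" if "m \<le> k" for m
    using that
  proof (induction m)
    case 0
    then show ?case using seq assms(1) by (simp add: reducing_seq_def)
  next
    case (Suc m)
    then have IH: "F (Suc m) \<subseteq> E \<inter> {x. \<forall>i\<in>{1..m}. z i \<bullet> x = 0}" by simp
    have "F (Suc (Suc m)) = {x \<in> F (Suc m). z (Suc m) \<bullet> x = 0}"
      using step(2)[of "Suc m"] Suc.prems IH by (simp add: Int_perp_eq)
    then show ?case using IH by (auto simp: le_Suc_eq subset_iff)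
  qed
  have "m \<le> dim (z ` {1..m})" if "m \<le> k" for m
    using that
  proof (induction m)
    case (Suc m)
    \<comment> \<open>A point lost in the next cut is orthogonal to the span of the earlier
      directions but not to the new one.\<close>
    obtain x where x: "x \<in> F (Suc m)" "x \<notin> F (Suc m + 1)" using strict[of "Suc m"] Suc by auto
    have xE: "x \<in> E" and perp: "\<And>i. i \<in> {1..m} \<Longrightarrow> z i \<bullet> x = 0" using sub[of m] x Suc by auto
    have "z (Suc m) \<bullet> x \<noteq> 0"
      using x xE step(2)[of "Suc m"] Suc by (auto simp: perp_def orthogonal_comp_def orthogonal_def)
    moreover have "orthogonal x y" if "y \<in> span (z ` {1..m})" for y
      using that by (rule orthogonal_to_span) (use perp in \<open>auto simp: orthogonal_def inner_commute\<close>)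
    ultimately have "z (Suc m) \<notin> span (z ` {1..m})" unfolding orthogonal_def by (metis inner_commute)
    then show ?case using Suc by (simp add: atLeastAtMostSuc_conv dim_insert)
  qed simp
  then have "k \<le> dim (z ` {1..k})" by simp
  also have "\<dots> \<le> dim (perp E L \<inter> perp E {a})" using step(1) by (intro dim_subset) auto
  finally show ?thesis .
qed

subsection \<open>Reduction to the minimal face\<close>

text \<open>Classical facial reduction, as the case of a trivial polyhedral part.\<close>

lemma facial_reduction_step:
  fixes E :: "'b::euclidean_space set"
  assumes F: "convex_cone F" "F \<subseteq> E" and E: "subspace E" "L \<subseteq> E" "a \<in> E" "subspace L"
    and "F \<inter> (+) a ` L \<noteq> {}" "rel_interior F \<inter> (+) a ` L = {}"
  shows "\<exists>z \<in> dual_cone E F \<inter> perp E L \<inter> perp E {a}. F \<inter> perp E {z} \<subset> F"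
proof -
  obtain s where "s \<in> F" "s \<in> (+) a ` L" using assms by blast
  then have "\<exists>z \<in> perp E L \<inter> perp E {a}. (\<forall>x\<in>F \<union> {0}. 0 \<le> z \<bullet> x) \<and> (\<exists>x\<in>F. z \<bullet> x \<noteq> 0)"
    using assms subspace_0[of E]
    by (intro partial_polyhedral_separation_affine[of F "{0}" E L a s 0]) (auto simp: affine_imp_polyhedron)
  then obtain z where "z \<in> perp E L \<inter> perp E {a}" "\<forall>x\<in>F. 0 \<le> z \<bullet> x" "\<exists>x\<in>F. z \<bullet> x \<noteq> 0" by blast
  then show ?thesis
    unfolding Int_perp_eq[OF F(2)]
    by (intro bexI[of _ z]) (auto simp: dual_cone_def perp_def)
qed

text \<open>A face that meets the relative interior of a convex subset contains this subset, and
  every face containing \<open>S\<close> meets \<open>rel_interior F\<close>.\<close>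

lemma face_eq_minimal_face:
  fixes K :: "'b::euclidean_space set"
  assumes K: "convex_cone K" and F: "cone_face F K" "S \<subseteq> F" and "rel_interior F \<inter> S \<noteq> {}"
  shows "F = minimal_face K S"
proof
  show "minimal_face K S \<subseteq> F" using F by (auto simp: minimal_face_def)
  have "F \<subseteq> H" if "cone_face H K" "S \<subseteq> H" for H
    using cone_face_imp_face_of[OF K that(1)] F that assms(4)
    by (intro subset_of_face_of[of H K F]) (auto simp: cone_face_def)
  then show "F \<subseteq> minimal_face K S" by (auto simp: minimal_face_def)
qed

text \<open>Supplies the existence behind \<open>LEAST\<close> in \<open>d_S\<close>. Each cut
  lowers the affine dimension; the measure adds 1 because that dimension can start at -1.\<close>

lemma minimal_face_reachable:
  fixes K :: "'b::euclidean_space set"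
  assumes K: "convex_cone K" "K \<subseteq> E" and E: "subspace E" "L \<subseteq> E" "a \<in> E" "subspace L"
    and ne: "K \<inter> (+) a ` L \<noteq> {}"
    and F: "cone_face F K" "K \<inter> (+) a ` L \<subseteq> F"
  shows "\<exists>k G z. reducing_seq E F L a k G z \<and> G (k + 1) = minimal_face K (K \<inter> (+) a ` L)"
  using F
proof (induction "nat (aff_dim F + 1)" arbitrary: F rule: less_induct)
  case less
  let ?S = "K \<inter> (+) a ` L"
  show ?case
  proof (cases "rel_interior F \<inter> (+) a ` L = {}")
    case False
    have "rel_interior F \<subseteq> K" using rel_interior_subset less.prems by (fastforce simp: cone_face_def)
    then have "F = minimal_face K ?S"
      using False by (intro face_eq_minimal_face[OF K(1) less.prems]) auto
    then have "reducing_seq E F L a 0 (\<lambda>_. F) (\<lambda>_. 0) \<and> F = minimal_face K ?S"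
      by (simp add: reducing_seq_def)
    then show ?thesis by blast
  next
    case True
    have F: "convex_cone F" "F \<subseteq> E" "F \<inter> (+) a ` L \<noteq> {}"
      using less.prems K ne unfolding cone_face_def by blast+
    from facial_reduction_step[OF F(1,2) E F(3) True]
    obtain z0 where z0: "z0 \<in> dual_cone E F \<inter> perp E L \<inter> perp E {a}" and lt: "F \<inter> perp E {z0} \<subset> F"
      by blast
    have face: "cone_face (F \<inter> perp E {z0}) F" using z0 F by (intro cone_face_Int_perp) auto
    have "aff_dim (F \<inter> perp E {z0}) < aff_dim F"
      using lt F cone_face_imp_face_of[OF F(1) face]
      by (intro face_of_aff_dim_lt) (auto simp: convex_cone_def)
    then have "nat (aff_dim (F \<inter> perp E {z0}) + 1) < nat (aff_dim F + 1)"
      using aff_dim_geq[of "F \<inter> perp E {z0}"] by linarith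
    moreover have "?S \<subseteq> F \<inter> perp E {z0}"
      using less.prems F z0 by (intro reducing_step_keeps_feasible[of ?S F a L]) auto
    ultimately obtain k G z where "reducing_seq E (F \<inter> perp E {z0}) L a k G z"
      "G (k + 1) = minimal_face K ?S"
      using less.hyps[of "F \<inter> perp E {z0}"] cone_face_trans[OF face less.prems(1)] by blast
    then show ?thesis using reducing_seq_Cons[OF z0] by metis
  qed
qed

text \<open>If the relative interior of the minimal face missed the affine space, a reduction step
  would produce a smaller face that still contains every feasible point.\<close>

lemma PPS_minimal_face:
  fixes K :: "'b::euclidean_space set"
  assumes K: "convex_cone K" "closed K" "K \<subseteq> E" and E: "subspace E" "L \<subseteq> E" "a \<in> E" "subspace L"
    and ne: "K \<inter> (+) a ` L \<noteq> {}"
    and face: "cone_face (minimal_face K (K \<inter> (+) a ` L)) K"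
  shows "PPS E (minimal_face K (K \<inter> (+) a ` L)) L a"
proof -
  let ?S = "K \<inter> (+) a ` L"
  define F where "F = minimal_face K ?S"
  have S: "?S \<subseteq> F" by (auto simp: F_def minimal_face_def)
  have F: "convex_cone F" "F \<subseteq> E" "F \<inter> (+) a ` L \<noteq> {}" "cone_face F K"
    using face K S ne unfolding F_def cone_face_def by blast+
  have "rel_interior F \<inter> (+) a ` L \<noteq> {}"
  proof
    assume "rel_interior F \<inter> (+) a ` L = {}"
    from facial_reduction_step[OF F(1,2) E F(3) this]
    obtain z0 where z0: "z0 \<in> dual_cone E F \<inter> perp E L \<inter> perp E {a}" and lt: "F \<inter> perp E {z0} \<subset> F"
      by blast
    have "cone_face (F \<inter> perp E {z0}) K"
      using z0 F cone_face_trans cone_face_Int_perp[of F E z0] by blast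
    moreover have "?S \<subseteq> F \<inter> perp E {z0}"
      using S F z0 by (intro reducing_step_keeps_feasible[of ?S F a L]) auto
    ultimately have "F \<subseteq> F \<inter> perp E {z0}" unfolding F_def minimal_face_def by blast
    then show False using lt by blast
  qed
  then obtain x where x: "x \<in> rel_interior F" "x \<in> (+) a ` L" by blast
  have "closed F"
    using face_of_imp_closed[OF _ K(2) cone_face_imp_face_of[OF K(1) F(4)]] K(1)
    by (simp add: convex_cone_def)
  moreover have "E = E + {0}" "F = F + {0}" by simp_all
  moreover have "x + 0 \<in> (+) a ` L" using x by simp
  moreover have "\<forall>x\<in>E. \<forall>y\<in>{0}. orthogonal x y" by (simp add: orthogonal_def)
  moreover have "subspace {0 :: 'b}" "closed {0 :: 'b}" "polyhedron {0 :: 'b}" "convex_cone {0 :: 'b}"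
    by (simp_all add: affine_imp_polyhedron)
  ultimately have "PPS E F L a"
    unfolding PPS_def using F(1,2) E(1) x(1) by blast
  then show ?thesis by (simp add: F_def)
qed

subsection \<open>Product cones\<close>

lemma cart_prod_mono: "(\<And>i. S i \<subseteq> T i) \<Longrightarrow> cart_prod S \<subseteq> cart_prod T"
  by (auto simp: cart_prod_def)

lemma convex_cone_cart_prod: "(\<And>i. convex_cone (S i)) \<Longrightarrow> convex_cone (cart_prod S)"
  by (auto simp: cart_prod_def convex_cone_iff)

lemma subspace_cart_prod: "(\<And>i. subspace (S i)) \<Longrightarrow> subspace (cart_prod S)"
  by (auto simp: cart_prod_def subspace_def)

lemma closed_cart_prod:
  fixes S :: "'s::finite \<Rightarrow> 'a::euclidean_space set"
  shows "(\<And>i. closed (S i)) \<Longrightarrow> closed (cart_prod S)"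
  by (simp add: cart_prod_def closed_vector_box)

lemma polyhedron_cart_prod:
  fixes S :: "'s::finite \<Rightarrow> 'a::euclidean_space set"
  assumes "\<And>i. polyhedron (S i)"
  shows "polyhedron (cart_prod S)"
proof -
  have "polyhedron {x :: 'a ^ 's. x $ i \<in> S i}" for i
  proof -
    obtain F p q where F: "finite F" "S i = \<Inter> F" and pq: "\<And>h. h \<in> F \<Longrightarrow> h = {x. p h \<bullet> x \<le> q h}"
      using assms[of i] unfolding polyhedron_def by metis
    \<comment> \<open>The map \<open>axis i\<close> is adjoint to the \<open>i\<close>-th
      coordinate, so it turns halfspaces of a factor into halfspaces of the product.\<close>
    have "x $ i \<in> h \<longleftrightarrow> axis i (p h) \<bullet> x \<le> q h" if "h \<in> F" for x :: "'a ^ 's" and h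
      by (subst pq[OF that]) (simp add: inner_axis')
    then have "x $ i \<in> S i \<longleftrightarrow> (\<forall>h\<in>F. axis i (p h) \<bullet> x \<le> q h)" for x :: "'a ^ 's"
      using F(2) by simp
    then have "{x :: 'a ^ 's. x $ i \<in> S i} = \<Inter> ((\<lambda>h. {x. axis i (p h) \<bullet> x \<le> q h}) ` F)"
      by auto
    then show ?thesis using F(1) by (auto simp: polyhedron_halfspace_le)
  qed
  moreover have "cart_prod S = \<Inter> (range (\<lambda>i. {x. x $ i \<in> S i}))" by (auto simp: cart_prod_def)
  ultimately show ?thesis by auto
qed

text \<open>\<open>PPS\<close> asks for an internal orthogonal sum, so factors outside a group are
  replaced by \<open>{0}\<close> instead of being dropped.\<close>

lemma cart_prod_split:
  fixes S :: "'s::finite \<Rightarrow> 'a::euclidean_space set"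
  assumes "\<And>i. 0 \<in> S i"
  shows "cart_prod S = cart_prod (\<lambda>i. if P i then {0} else S i) + cart_prod (\<lambda>i. if P i then S i else {0})"
    (is "_ = ?A + ?B")
proof
  show "cart_prod S \<subseteq> ?A + ?B"
  proof
    fix x assume "x \<in> cart_prod S"
    then have "(\<chi> i. if P i then 0 else x $ i) + (\<chi> i. if P i then x $ i else 0) \<in> ?A + ?B"
      by (intro set_plus_intro) (auto simp: cart_prod_def)
    moreover have "x = (\<chi> i. if P i then 0 else x $ i) + (\<chi> i. if P i then x $ i else 0)"
      by (simp add: vec_eq_iff)
    ultimately show "x \<in> ?A + ?B" by simp
  qed
  show "?A + ?B \<subseteq> cart_prod S"
  proof
    fix x assume "x \<in> ?A + ?B"
    then obtain u v where uv: "x = u + v" "u \<in> ?A" "v \<in> ?B" by (rule set_plus_elim)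
    have "x $ i \<in> S i" for i
      using uv by (cases "P i") (auto simp: cart_prod_def dest!: spec[of _ i])
    then show "x \<in> cart_prod S" by (simp add: cart_prod_def)
  qed
qed

lemma dual_cone_cart_prod_nth:
  assumes "\<And>i. 0 \<in> S i" "z \<in> dual_cone E (cart_prod S)" "x \<in> S i"
  shows "0 \<le> z $ i \<bullet> x"
proof -
  have "axis i x \<in> cart_prod S" using assms by (auto simp: cart_prod_def axis_def)
  then have "0 \<le> z \<bullet> axis i x" using assms(2) by (auto simp: dual_cone_def)
  then show ?thesis by (simp add: inner_axis)
qed

text \<open>On the product, \<open>z \<bullet> x\<close> is a sum of nonnegative terms and vanishes
  only if every term does. Cuts therefore stay product cones, which keeps the induction over the
  factors going.\<close>

lemma cart_prod_Int_perp:
  assumes "\<And>i. 0 \<in> S i" "cart_prod S \<subseteq> E" "z \<in> dual_cone E (cart_prod S)"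
  shows "cart_prod S \<inter> perp E {z} = cart_prod (\<lambda>i. {x \<in> S i. z $ i \<bullet> x = 0})"
proof -
  have "(z \<bullet> x = 0) = (\<forall>i. z $ i \<bullet> x $ i = 0)" if "x \<in> cart_prod S" for x
  proof -
    have "0 \<le> z $ i \<bullet> x $ i" for i
      using dual_cone_cart_prod_nth[OF assms(1,3)] that by (auto simp: cart_prod_def)
    then show ?thesis unfolding inner_vec_def by (simp add: sum_nonneg_eq_0_iff)
  qed
  then show ?thesis unfolding Int_perp_eq[OF assms(2)] by (auto simp: cart_prod_def)
qed

lemma PPS_reduction_step:
  fixes Es Ks :: "'s::finite \<Rightarrow> 'a::euclidean_space set"
  assumes Es: "\<And>i. subspace (Es i)" and Ks: "\<And>i. Ks i \<subseteq> Es i" "\<And>i. closed (Ks i)" "\<And>i. convex_cone (Ks i)"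
    and L: "subspace L" "L \<subseteq> cart_prod Es" "a \<in> cart_prod Es"
    and ne: "cart_prod Ks \<inter> (+) a ` L \<noteq> {}"
    and fails: "\<not> PPS (cart_prod Es) (cart_prod Ks) L a"
  obtains z i x where "z \<in> dual_cone (cart_prod Es) (cart_prod Ks) \<inter> perp (cart_prod Es) L \<inter> perp (cart_prod Es) {a}"
    "\<not> polyhedron (Ks i)" "x \<in> Ks i" "z $ i \<bullet> x \<noteq> 0"
proof -
  \<comment> \<open>The test refers to \<open>Ks\<close> even when \<open>S\<close> is
    \<open>Es\<close>, so that spaces and cones are split along the same indices.\<close>
  define A where "A S i = (if polyhedron (Ks i) then {0} else S i)" for S :: "'s \<Rightarrow> 'a set" and i
  define B where "B S i = (if polyhedron (Ks i) then S i else {0})" for S :: "'s \<Rightarrow> 'a set" and i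
  have zero: "0 \<in> Es i" "0 \<in> Ks i" for i
    using subspace_0[OF Es] convex_cone_contains_0[OF Ks(3)] by auto
  have splitE: "cart_prod Es = cart_prod (A Es) + cart_prod (B Es)"
    and splitK: "cart_prod Ks = cart_prod (A Ks) + cart_prod (B Ks)"
    unfolding A_def B_def using zero by (auto intro!: cart_prod_split)
  have cones: "convex_cone (cart_prod (A Ks))" "convex_cone (cart_prod (B Ks))"
    "closed (cart_prod (A Ks))" "closed (cart_prod (B Ks))" "polyhedron (cart_prod (B Ks))"
    using Ks by (auto simp: A_def B_def affine_imp_polyhedron
        intro!: convex_cone_cart_prod closed_cart_prod polyhedron_cart_prod)
  have spaces: "subspace (cart_prod (A Es))" "subspace (cart_prod (B Es))"
    "cart_prod (A Ks) \<subseteq> cart_prod (A Es)" "cart_prod (B Ks) \<subseteq> cart_prod (B Es)"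
    using Es subsetD[OF Ks(1)] by (auto simp: A_def B_def intro!: subspace_cart_prod cart_prod_mono)
  have ortho: "u \<bullet> v = 0" if "u \<in> cart_prod (A Es)" "v \<in> cart_prod (B Es)" for u v
  proof -
    have "u $ i \<bullet> v $ i = 0" for i
      using that by (cases "polyhedron (Ks i)") (auto simp: cart_prod_def A_def B_def dest!: spec[of _ i])
    then show ?thesis by (simp add: inner_vec_def)
  qed
  have ortho': "u \<bullet> v = 0" if "u \<in> cart_prod (A Ks)" "v \<in> cart_prod (B Ks)" for u v
    using ortho that spaces(3,4) by blast
  have disj: "u + v \<notin> (+) a ` L" if "u \<in> rel_interior (cart_prod (A Ks))" "v \<in> cart_prod (B Ks)" for u v
  proof
    assume "u + v \<in> (+) a ` L"
    then have "PPS (cart_prod Es) (cart_prod Ks) L a"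
      unfolding PPS_def orthogonal_def using that splitE splitK cones spaces ortho by blast
    then show False using fails by blast
  qed
  have subE: "cart_prod Ks \<subseteq> cart_prod Es" "cart_prod (A Ks) \<subseteq> cart_prod Es" "cart_prod (B Ks) \<subseteq> cart_prod Es"
    using Ks(1) zero by (auto simp: A_def B_def cart_prod_def split: if_splits) (metis singletonD subsetD)+
  obtain s where "s \<in> cart_prod Ks" "s \<in> (+) a ` L" using ne by blast
  then obtain s1 s2 where s: "s1 \<in> cart_prod (A Ks)" "s2 \<in> cart_prod (B Ks)" "s1 + s2 \<in> (+) a ` L"
    unfolding splitK by (auto elim!: set_plus_elim)
  have "\<exists>z \<in> perp (cart_prod Es) L \<inter> perp (cart_prod Es) {a}.
      (\<forall>x\<in>cart_prod (A Ks) \<union> cart_prod (B Ks). 0 \<le> z \<bullet> x) \<and> (\<exists>x\<in>cart_prod (A Ks). z \<bullet> x \<noteq> 0)"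
    by (rule partial_polyhedral_separation_affine[OF cones(1,2,5) ortho'
        subspace_cart_prod[OF Es] subE(2,3) L(2,3,1) s disj])
  then obtain z x where z: "z \<in> perp (cart_prod Es) L \<inter> perp (cart_prod Es) {a}"
    and zK: "\<forall>x\<in>cart_prod (A Ks) \<union> cart_prod (B Ks). 0 \<le> z \<bullet> x"
    and x: "x \<in> cart_prod (A Ks)" "z \<bullet> x \<noteq> 0" by blast
  have "0 \<le> z \<bullet> y" if y: "y \<in> cart_prod Ks" for y
  proof -
    obtain u v where "y = u + v" "u \<in> cart_prod (A Ks)" "v \<in> cart_prod (B Ks)"
      using y unfolding splitK by (rule set_plus_elim)
    then show ?thesis using zK by (auto simp: inner_right_distrib)
  qed
  then have "z \<in> dual_cone (cart_prod Es) (cart_prod Ks)" using z by (auto simp: dual_cone_def perp_def)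
  moreover obtain i where "z $ i \<bullet> x $ i \<noteq> 0"
    using x(2) unfolding inner_vec_def by (meson sum.neutral)
  moreover have "x $ i \<in> A Ks i" using x(1) by (auto simp: cart_prod_def)
  \<comment> \<open>At a polyhedral index \<open>A Ks i\<close> is \<open>{0}\<close>, where the
    inner product is 0; hence the index found is a non-polyhedral one.\<close>
  ultimately show thesis
    using that[of z i "x $ i"] z by (cases "polyhedron (Ks i)") (auto simp: A_def)
qed

text \<open>The induction generalizes over \<open>Ks\<close>, since a cut changes the factors and
  which of them are polyhedral. Every cut is paid for by a drop of at least 1 in the sum, which
  bounds \<open>k\<close>.\<close>

lemma PPS_reachable:
  fixes Es Ks :: "'s::finite \<Rightarrow> 'a::euclidean_space set"
  assumes Es: "\<And>i. subspace (Es i)" and L: "subspace L" "L \<subseteq> cart_prod Es" "a \<in> cart_prod Es"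
    and Ks: "\<And>i. Ks i \<subseteq> Es i" "\<And>i. closed (Ks i)" "\<And>i. convex_cone (Ks i)" "\<And>i. pointed (Ks i)"
    and ne: "cart_prod Ks \<inter> (+) a ` L \<noteq> {}"
  shows "\<exists>k F z. k \<le> (\<Sum>i\<in>UNIV. l_poly (Ks i)) \<and> reducing_seq (cart_prod Es) (cart_prod Ks) L a k F z \<and>
    PPS (cart_prod Es) (F (k + 1)) L a"
  using Ks ne
proof (induction "\<Sum>i\<in>UNIV. l_poly (Ks i)" arbitrary: Ks rule: less_induct)
  case less
  note Ks = less.prems(1-4)
  let ?E = "cart_prod Es"
  show ?case
  proof (cases "PPS ?E (cart_prod Ks) L a")
    case True
    then have "reducing_seq ?E (cart_prod Ks) L a 0 (\<lambda>_. cart_prod Ks) (\<lambda>_. 0) \<and> PPS ?E (cart_prod Ks) L a"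
      by (simp add: reducing_seq_def)
    then show ?thesis by (intro exI[of _ 0]) auto
  next
    case False
    obtain z0 i0 x0 where z0: "z0 \<in> dual_cone ?E (cart_prod Ks) \<inter> perp ?E L \<inter> perp ?E {a}"
      and i0: "\<not> polyhedron (Ks i0)" "x0 \<in> Ks i0" "z0 $ i0 \<bullet> x0 \<noteq> 0"
      using PPS_reduction_step[OF Es Ks(1-3) L less.prems(5) False] by blast
    define Ks' where "Ks' i = {x \<in> Ks i. z0 $ i \<bullet> x = 0}" for i
    have zero: "0 \<in> Ks i" for i using convex_cone_contains_0[OF Ks(3)] .
    have KE: "cart_prod Ks \<subseteq> ?E" using Ks(1) by (rule cart_prod_mono)
    have eq: "cart_prod Ks \<inter> perp ?E {z0} = cart_prod Ks'"
      using z0 zero KE unfolding Ks'_def by (intro cart_prod_Int_perp) auto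
    have face: "cone_face (Ks' i) (Ks i)" for i
      unfolding Ks'_def using dual_cone_cart_prod_nth[of Ks z0 ?E] z0 zero Ks(3)
      by (intro cone_face_exposed) auto
    have Ks': "Ks' i \<subseteq> Es i" "closed (Ks' i)" "convex_cone (Ks' i)" "pointed (Ks' i)" for i
    proof -
      show cc: "convex_cone (Ks' i)" using face[of i] by (simp add: cone_face_def)
      show "Ks' i \<subseteq> Es i" using Ks(1) by (auto simp: Ks'_def)
      show "closed (Ks' i)"
        using closed_Int[OF Ks(2)[of i] closed_hyperplane[of "z0 $ i" 0]]
        by (simp add: Ks'_def Int_def)
      show "pointed (Ks' i)" by (rule pointed_subset[OF Ks(4) cc]) (auto simp: Ks'_def)
    qed
    have "Ks' i0 \<noteq> Ks i0" using i0 by (auto simp: Ks'_def)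
    \<comment> \<open>Only \<open>i0\<close> is sure to drop. The cut may act on other factors as
      well, where monotonicity is enough.\<close>
    then have "l_poly (Ks' i0) < l_poly (Ks i0)" using i0 face Ks by (intro l_poly_less) auto
    moreover have "l_poly (Ks' i) \<le> l_poly (Ks i)" for i using face Ks by (intro l_poly_mono) auto
    ultimately have lt: "(\<Sum>i\<in>UNIV. l_poly (Ks' i)) < (\<Sum>i\<in>UNIV. l_poly (Ks i))"
      by (intro sum_strict_mono_ex1) auto
    have "cart_prod Ks \<inter> (+) a ` L \<subseteq> cart_prod Ks'"
      using z0 KE unfolding eq[symmetric] by (intro reducing_step_keeps_feasible[of _ _ a L]) auto
    then have "cart_prod Ks' \<inter> (+) a ` L \<noteq> {}" using less.prems(5) by blast
    with less.hyps[OF lt Ks'] obtain k F z where k: "k \<le> (\<Sum>i\<in>UNIV. l_poly (Ks' i))"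
      and seq: "reducing_seq ?E (cart_prod Ks') L a k F z" and pps: "PPS ?E (F (k + 1)) L a" by blast
    obtain F' z' where "reducing_seq ?E (cart_prod Ks) L a (Suc k) F' z'" "F' (Suc k + 1) = F (k + 1)"
      using reducing_seq_Cons[OF z0] seq unfolding eq by blast
    moreover have "Suc k \<le> (\<Sum>i\<in>UNIV. l_poly (Ks i))" using k lt by simp
    ultimately show ?thesis using pps by metis
  qed
qed

theorem proposition24:
  fixes Es Ks :: "'s::finite \<Rightarrow> 'a::euclidean_space set"
    and E K L :: "('a ^ 's) set" and a :: "'a ^ 's"
  assumes "\<And>i. subspace (Es i)"
    and "\<And>i. Ks i \<subseteq> Es i"
    and "\<And>i. closed (Ks i)" and "\<And>i. convex_cone (Ks i)" and "\<And>i. pointed (Ks i)"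
    and "E = cart_prod Es" and "K = cart_prod Ks"
    and "subspace L" and "L \<subseteq> E" and "a \<in> E"
    and "K \<inter> (+) a ` L \<noteq> {}"
  shows
    "(\<exists>F z. F 1 = K \<and>
        (\<forall>i\<in>{1..d_PPS E K L a + 1}. cone_face (F i) K) \<and>
        (\<forall>i\<in>{1..d_PPS E K L a}.
           F (i + 1) \<subset> F i \<and>
           z i \<in> dual_cone E (F i) \<inter> perp E L \<inter> perp E {a} \<and>
           F (i + 1) = F i \<inter> perp E {z i}) \<and>
        PPS E (F (d_PPS E K L a + 1)) L a) \<and>
     d_PPS E K L a \<le> (\<Sum>i\<in>UNIV. l_poly (Ks i)) \<and>
     d_PPS E K L a \<le> dim (perp E L \<inter> perp E {a}) \<and>
     d_PPS E K L a \<le> d_S E K L a"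
proof -
  define P where "P k \<longleftrightarrow> (\<exists>F z. reducing_seq E K L a k F z \<and> PPS E (F (k + 1)) L a)" for k
  define Q where "Q k \<longleftrightarrow> (\<exists>F z. reducing_seq E K L a k F z \<and> F (k + 1) = minimal_face K (K \<inter> (+) a ` L))" for k
  have dP: "d_PPS E K L a = (LEAST k. P k)" and dS: "d_S E K L a = (LEAST k. Q k)"
    by (simp_all add: d_PPS_def d_S_def P_def Q_def)
  have E: "subspace E" "L \<subseteq> E" "a \<in> E" "subspace L"
    using assms subspace_cart_prod[of Es] by auto
  have K: "convex_cone K" "closed K" "K \<subseteq> E"
    using assms convex_cone_cart_prod[of Ks] closed_cart_prod[of Ks] cart_prod_mono[of Ks Es] by auto
  obtain k where "k \<le> (\<Sum>i\<in>UNIV. l_poly (Ks i))" "P k"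
    using PPS_reachable[of Es L a Ks] assms unfolding P_def by auto
  then have i: "d_PPS E K L a \<le> (\<Sum>i\<in>UNIV. l_poly (Ks i))" and Pd: "P (d_PPS E K L a)"
    unfolding dP by (auto intro: LeastI Least_le order_trans)
  have "P k" if Qk: "Q k" for k
  proof -
    obtain F z where F: "reducing_seq E K L a k F z" "F (k + 1) = minimal_face K (K \<inter> (+) a ` L)"
      using Qk unfolding Q_def by blast
    have "cone_face (F (k + 1)) K" using reducing_seq_faces[OF K(1,3) F(1)] by simp
    then have "PPS E (F (k + 1)) L a"
      unfolding F(2) by (intro PPS_minimal_face K E assms)
    then show ?thesis using F(1) by (auto simp: P_def)
  qed
  \<comment> \<open>Without a witness, \<open>LEAST\<close> would reveal nothing about
    \<open>d_S\<close>.\<close>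
  moreover have "\<exists>k. Q k"
    unfolding Q_def by (intro minimal_face_reachable[OF K(1,3) E assms(11)] cone_face_refl K) auto
  ultimately have iii: "d_PPS E K L a \<le> d_S E K L a"
    unfolding dP dS by (metis LeastI_ex Least_le)
  obtain F z where seq: "reducing_seq E K L a (d_PPS E K L a) F z" and pps: "PPS E (F (d_PPS E K L a + 1)) L a"
    using Pd unfolding P_def by blast
  have strict: "F (i + 1) \<subset> F i" if i: "i \<in> {1..d_PPS E K L a}" for i
  proof -
    obtain k where k: "d_PPS E K L a = Suc k" using i by (cases "d_PPS E K L a") auto
    have "F (i + 1) \<noteq> F i"
    proof
      \<comment> \<open>Omitting the idle cut would realize \<open>P k\<close> for a
        \<open>k\<close> below the minimum.\<close>
      assume "F (i + 1) = F i"
      then obtain F' z' where "reducing_seq E K L a k F' z'" "F' (k + 1) = F (Suc k + 1)"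
        using reducing_seq_drop_repetition[of E K L a k F z i] seq i unfolding k by blast
      then have "P k" using pps unfolding P_def k by metis
      then show False using k unfolding dP by (metis Least_le not_less_eq_eq order_refl)
    qed
    then show ?thesis using seq i by (auto simp: reducing_seq_def)
  qed
  have ii: "d_PPS E K L a \<le> dim (perp E L \<inter> perp E {a})"
    using strict_reducing_seq_length[OF K(3) seq strict] .
  have "F 1 = K \<and> (\<forall>i\<in>{1..d_PPS E K L a + 1}. cone_face (F i) K) \<and>
      (\<forall>i\<in>{1..d_PPS E K L a}. F (i + 1) \<subset> F i \<and>
         z i \<in> dual_cone E (F i) \<inter> perp E L \<inter> perp E {a} \<and> F (i + 1) = F i \<inter> perp E {z i}) \<and>
      PPS E (F (d_PPS E K L a + 1)) L a"
    using seq pps strict reducing_seq_faces[OF K(1,3) seq] unfolding reducing_seq_def by auto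
  then show ?thesis using i ii iii by blast
qed

end
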